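(* Let $T$ and $S$ be commuting mean ergodic contractions on a Banach space $X$, with $F(T)=F(S)$. Then $(I-T)(I-S)X$ is closed in $X$ if and only if both $T$ and $S$ are uniformly ergodic.
   Context: A contraction of a Banach space $X$ is a linear operator $T:X\to X$ with $\|T\|\le 1$. $F(T)=\{x\in X: Tx=x\}$. A contraction $T$ is mean ergodic if the averages $\frac1n\sum_{k=0}^{n-1}T^k$ converge in the strong operator topology, and uniformly ergodic if they converge in operator norm. *)

theory Defs
  imports "HOL-Analysis.Analysis"
begin

text \<open>
  A bounded operator on a Banach space is an element of the library type of bounded linear
  functions, whose norm is the operator norm. Scalars are real; a complex Banach space with a
  complex-linear operator is covered by restriction of scalars, which changes neither the norm
  nor any of the notions below.
\<close>

definition contraction_op :: "('a::real_normed_vector \<Rightarrow>\<^sub>L 'a) \<Rightarrow> bool" where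
  "contraction_op T \<longleftrightarrow> norm T \<le> 1"

definition fixed_space :: "('a::real_normed_vector \<Rightarrow>\<^sub>L 'a) \<Rightarrow> 'a set" where
  "fixed_space T = {x. blinfun_apply T x = x}"

primrec op_power :: "('a::real_normed_vector \<Rightarrow>\<^sub>L 'a) \<Rightarrow> nat \<Rightarrow> ('a \<Rightarrow>\<^sub>L 'a)" where
  "op_power T 0 = id_blinfun"
| "op_power T (Suc k) = T o\<^sub>L op_power T k"

text \<open>At \<open>n = 0\<close> the average is the zero operator; only its limit along \<open>n\<close> is ever used.\<close>

definition ergodic_average :: "('a::real_normed_vector \<Rightarrow>\<^sub>L 'a) \<Rightarrow> nat \<Rightarrow> ('a \<Rightarrow>\<^sub>L 'a)" where
  "ergodic_average T n = (1 / real n) *\<^sub>R (\<Sum>k<n. op_power T k)"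

definition mean_ergodic :: "('a::real_normed_vector \<Rightarrow>\<^sub>L 'a) \<Rightarrow> bool" where
  "mean_ergodic T \<longleftrightarrow>
     (\<exists>P. limitin strong_operator_topology (ergodic_average T) P sequentially)"

definition uniformly_ergodic :: "('a::real_normed_vector \<Rightarrow>\<^sub>L 'a) \<Rightarrow> bool" where
  "uniformly_ergodic T \<longleftrightarrow> convergent (ergodic_average T)"

end

theory Submission
  imports Defs
begin

text \<open>
  Commuting mean ergodic contractions with the same fixed space have the same ergodic projection
  \<open>P\<close>, and \<open>ker P\<close> is the closure of both \<open>(I - T)X\<close> and \<open>(I - S)X\<close>. Hence \<open>(I - T)(I - S)X\<close> is dense
  in \<open>ker P\<close>, so if it is closed, then \<open>(I - T)X = (I - S)X = ker P\<close>. By M. Lin's theorem, \<open>T\<close> is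
  uniformly ergodic if and only if \<open>(I - T)X\<close> is closed: closedness yields, through the open
  mapping theorem, bounded solutions \<open>z\<close> of \<open>z - T z = x - P x\<close>, and
  \<open>A\<^sub>n x - P x = (z - T\<^sup>n z) / n\<close>. Conversely, if both operators are uniformly ergodic,
  then \<open>(I - T)(I - S)X = (I - T)(ker P) = (I - T)X = ker P\<close>.
\<close>

section \<open>Bounded linear operators with closed range\<close>

text \<open>The Baire half of the open mapping theorem, with the closed range as target space: the
  closures of the images of balls of integer radius cover the range, so one of them has interior
  relative to it.\<close>

lemma closed_range_ball_subset_closure_image:
  fixes f :: "'a::banach \<Rightarrow>\<^sub>L 'b::banach"
  assumes "closed (range f)"
  obtains n :: nat and r :: real
  where "r > 0" "range f \<inter> ball 0 r \<subseteq> closure (f ` cball 0 (real n))"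
proof -
  define Y where "Y = range f"
  define K where "K n = closure (f ` cball 0 (real n))" for n :: nat
  have closY: "closed Y" and lin: "linear f" and Y0: "Y \<noteq> {}"
    using assms by (auto simp: Y_def bounded_linear.linear[OF blinfun.bounded_linear_right])
  have subY: "subspace Y"
    unfolding Y_def using lin by (simp add: linear_subspace_image)
  have KY: "K n \<subseteq> Y" for n
    unfolding K_def using closY by (intro closure_minimal) (auto simp: Y_def)
  have "(\<Union>(range K)) = Y"
  proof
    show "Y \<subseteq> \<Union>(range K)"
    proof
      fix y assume "y \<in> Y"
      then obtain x where x: "y = f x" by (auto simp: Y_def)
      obtain n :: nat where "norm x \<le> real n" using real_arch_simple by blast
      then have "y \<in> f ` cball 0 (real n)" using x by auto
      then have "y \<in> K n" unfolding K_def by (rule subsetD[OF closure_subset])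
      then show "y \<in> \<Union>(range K)" by blast
    qed
  qed (use KY in blast)
  then have "top_of_set Y interior_of \<Union>(range K) = Y"
    by (metis interior_of_topspace topspace_euclidean_subtopology)
  with Y0 have "top_of_set Y interior_of \<Union>(range K) \<noteq> {}"
    by blast
  moreover have "completely_metrizable_space (top_of_set Y)"
    using closY
    by (simp add: completely_metrizable_space_closedin completely_metrizable_space_euclidean)
  moreover have "closedin (top_of_set Y) (K n)" for n
    using KY by (simp add: K_def closed_subset)
  ultimately have "\<not> (\<forall>n. top_of_set Y interior_of K n = {})"
    using Baire_category_alt[of "top_of_set Y" "range K"] by force
  then obtain n where "top_of_set Y interior_of K n \<noteq> {}" by blast
  then obtain y0 U where U: "openin (top_of_set Y) U" "y0 \<in> U" "U \<subseteq> K n"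
    by (auto simp: interior_of_def)
  then obtain r where r: "r > 0" "ball y0 r \<inter> Y \<subseteq> U"
    by (meson openin_contains_ball)
  have y0: "y0 \<in> Y" using U KY by blast
  \<comment> \<open>Convexity and symmetry of \<open>K n\<close> move the relative ball around
    \<open>y0\<close> to the origin.\<close>
  have conv: "convex (K n)"
    unfolding K_def by (intro convex_closure convex_linear_image lin convex_cball)
  have neg: "- z \<in> K n" if "z \<in> K n" for z
  proof -
    have "uminus ` K n \<subseteq> K n"
      unfolding K_def
    proof (rule image_closure_subset)
      have "- f x \<in> f ` cball 0 (real n)" if "norm x \<le> real n" for x
        using that by (intro image_eqI[of _ _ "- x"]) (auto simp: blinfun.minus_right)
      then show "uminus ` f ` cball 0 (real n) \<subseteq> closure (f ` cball 0 (real n))"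
        by (force intro: subsetD[OF closure_subset])
    qed (auto intro: continuous_intros)
    with that show ?thesis by auto
  qed
  have "y \<in> K n" if y: "y \<in> Y" "norm y < r" for y
  proof -
    have "y0 + y \<in> K n" "y0 - y \<in> K n"
      using U(3) r y y0 subY by (auto simp: subset_iff dist_norm subspace_add subspace_diff)
    \<comment> \<open>\<open>y\<close> is the midpoint of \<open>y0 + y\<close> and
      \<open>- (y0 - y)\<close>.\<close>
    then have "(1/2) *\<^sub>R (y0 + y) + (1/2) *\<^sub>R (- (y0 - y)) \<in> K n"
      by (intro convexD[OF conv] neg) auto
    then show ?thesis
      by (simp add: algebra_simps flip: scaleR_add_left)
  qed
  then have "range f \<inter> ball 0 r \<subseteq> closure (f ` cball 0 (real n))"
    unfolding K_def Y_def by auto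
  with r(1) show ?thesis by (rule that)
qed

text \<open>One step of an iteration: the factor 1/2 makes the remaining error decay
  geometrically.\<close>

lemma closed_range_approximate_preimage:
  fixes f :: "'a::banach \<Rightarrow>\<^sub>L 'b::banach"
  assumes "closed (range f)"
  obtains M :: real where "M \<ge> 0"
    "\<And>y. y \<in> range f \<Longrightarrow> \<exists>x. norm x \<le> M * norm y \<and> norm (y - f x) \<le> norm y / 2"
proof -
  obtain n r where r: "r > 0" and sub: "range f \<inter> ball 0 r \<subseteq> closure (f ` cball 0 (real n))"
    using closed_range_ball_subset_closure_image[OF assms] by blast
  have "\<exists>x. norm x \<le> (2 * real n / r) * norm y \<and> norm (y - f x) \<le> norm y / 2"
    if y: "y \<in> range f" for y
  proof (cases "y = 0")
    case False
    \<comment> \<open>Scaling by \<open>c\<close> gives \<open>y\<close> the norm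
      \<open>r / 2\<close>, inside the ball; an error below \<open>r / 4\<close> there becomes at
      most \<open>norm y / 2\<close> after division by \<open>c\<close>.\<close>
    define c where "c = r / (2 * norm y)"
    have c: "c > 0" "c * norm y = r / 2" using False r by (auto simp: c_def)
    from y have "c *\<^sub>R y \<in> range f"
      by (auto simp flip: blinfun.scaleR_right)
    then have "c *\<^sub>R y \<in> closure (f ` cball 0 (real n))"
      by (rule subsetD[OF sub IntI]) (use c r in simp)
    then obtain x where x: "norm x \<le> real n" "dist (f x) (c *\<^sub>R y) < r / 4"
      using r unfolding closure_approachable by (force dest: spec[of _ "r / 4"])
    have "norm (y - f (x /\<^sub>R c)) = norm ((c *\<^sub>R y - f x) /\<^sub>R c)"
      using c(1) by (simp add: blinfun.scaleR_right scaleR_diff_right)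
    also have "\<dots> = dist (f x) (c *\<^sub>R y) / c"
      using c(1) by (simp add: dist_norm norm_minus_commute divide_inverse mult.commute)
    also have "\<dots> \<le> (r / 4) / c"
      using x(2) c(1) by (intro divide_right_mono) auto
    also have "\<dots> = norm y / 2"
      using r False by (simp add: c_def field_simps)
    finally have "norm (y - f (x /\<^sub>R c)) \<le> norm y / 2" .
    moreover have "norm (x /\<^sub>R c) \<le> (2 * real n / r) * norm y"
      using x(1) c(1) r False by (simp add: c_def field_simps mult_right_mono)
    ultimately show ?thesis by blast
  qed (auto intro!: exI[of _ 0])
  then show ?thesis using that[of "2 * real n / r"] r by auto
qed

text \<open>Successive approximation: the corrections form an absolutely convergent series, and its
  sum is the preimage. Summing the powers of 1/2 doubles the constant \<open>M\<close>.\<close>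

lemma closed_range_bounded_preimage:
  fixes f :: "'a::banach \<Rightarrow>\<^sub>L 'b::banach"
  assumes "closed (range f)"
  obtains C :: real where "C \<ge> 0"
    "\<And>y. y \<in> range f \<Longrightarrow> \<exists>x. f x = y \<and> norm x \<le> C * norm y"
proof -
  obtain M where M: "M \<ge> 0"
    and "\<And>y. y \<in> range f \<Longrightarrow> \<exists>x. norm x \<le> M * norm y \<and> norm (y - f x) \<le> norm y / 2"
    using closed_range_approximate_preimage[OF assms] by blast
  then obtain g where g: "\<And>y. y \<in> range f \<Longrightarrow> norm (g y) \<le> M * norm y"
      "\<And>y. y \<in> range f \<Longrightarrow> norm (y - f (g y)) \<le> norm y / 2"
    by metis
  have "\<exists>x. f x = y \<and> norm x \<le> (2 * M) * norm y" if y: "y \<in> range f" for y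
  proof -
    \<comment> \<open>\<open>u k\<close> is the error left after \<open>k\<close> corrections; it
      stays in the range, where the bounds on \<open>g\<close> apply.\<close>
    define u where "u k = ((\<lambda>z. z - f (g z)) ^^ k) y" for k
    have u_Suc: "u (Suc k) = u k - f (g (u k))" for k by (simp add: u_def)
    have u_range: "u k \<in> range f" for k
    proof (induction k)
      case 0 then show ?case using y by (simp add: u_def)
    next
      case (Suc k)
      then obtain x where "u k = f x" by auto
      then have "u (Suc k) = f (x - g (u k))" by (simp add: u_Suc blinfun.diff_right)
      then show ?case by auto
    qed
    have u_norm: "norm (u k) \<le> norm y * (1/2) ^ k" for k
    proof (induction k)
      case (Suc k)
      have "norm (u (Suc k)) \<le> norm (u k) / 2" using g(2) u_range by (simp add: u_Suc)
      with Suc show ?case by simp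
    qed (simp add: u_def)
    have geom: "(\<lambda>k. (M * norm y) * (1/2) ^ k) sums (M * norm y * 2)"
      using sums_mult[OF geometric_sums[of "1/2::real"]] by simp
    have bound: "norm (g (u k)) \<le> (M * norm y) * (1/2) ^ k" for k
      using order_trans[OF g(1)[OF u_range] mult_left_mono[OF u_norm M]] by (simp add: mult.assoc)
    have summ: "summable (\<lambda>k. g (u k))"
      by (rule summable_comparison_test'[OF sums_summable[OF geom]]) (rule bound)
    have "(\<lambda>k. norm y * (1/2) ^ k) \<longlonglongrightarrow> 0"
      using tendsto_mult_right_zero[OF LIMSEQ_realpow_zero[of "1/2::real"]] by simp
    then have "u \<longlonglongrightarrow> 0"
      by (rule Lim_null_comparison[rotated]) (use u_norm in simp)
    \<comment> \<open>The image of each correction is a difference of consecutive errors, so the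
      images telescope to \<open>y\<close>.\<close>
    then have "(\<lambda>k. u k - u (Suc k)) sums (u 0 - 0)"
      by (rule telescope_sums')
    then have "(\<lambda>k. f (g (u k))) sums y"
      by (simp add: u_Suc) (simp add: u_def)
    moreover have "(\<lambda>k. f (g (u k))) sums f (\<Sum>k. g (u k))"
      by (rule bounded_linear.sums[OF blinfun.bounded_linear_right summable_sums[OF summ]])
    ultimately have "f (\<Sum>k. g (u k)) = y" by (simp add: sums_unique2)
    moreover have "norm (\<Sum>k. g (u k)) \<le> M * norm y * 2"
      using norm_suminf_le[OF bound sums_summable[OF geom]] sums_unique[OF geom] by simp
    ultimately show ?thesis by (auto simp: mult_ac)
  qed
  with M show ?thesis using that[of "2 * M"] by simp
qed

section \<open>The mean ergodic projection\<close>

lemma op_power_commute: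
  assumes "T o\<^sub>L S = S o\<^sub>L T"
  shows "op_power T k o\<^sub>L S = S o\<^sub>L op_power T k"
proof (rule blinfun_eqI)
  fix x
  have "T (S z) = S (T z)" for z using assms by (metis blinfun_apply_blinfun_compose)
  then show "(op_power T k o\<^sub>L S) x = (S o\<^sub>L op_power T k) x"
    by (induction k) auto
qed

lemma norm_op_power_le_one:
  assumes "contraction_op T"
  shows "norm (op_power T k) \<le> 1"
proof (induction k)
  case 0
  show ?case by (simp add: norm_blinfun_id_le)
next
  case (Suc k)
  have "norm (op_power T (Suc k)) \<le> norm T * norm (op_power T k)"
    by (simp add: norm_blinfun_compose)
  also have "\<dots> \<le> 1"
    using assms Suc by (intro mult_le_one) (auto simp: contraction_op_def)
  finally show ?case .
qed

lemma ergodic_average_apply: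
  "ergodic_average T n x = (1 / real n) *\<^sub>R (\<Sum>k<n. op_power T k x)"
  by (simp add: ergodic_average_def blinfun.scaleR_left blinfun.sum_left)

lemma ergodic_average_commute:
  assumes "T o\<^sub>L S = S o\<^sub>L T"
  shows "ergodic_average T n (S x) = S (ergodic_average T n x)"
proof -
  have "op_power T k (S x) = S (op_power T k x)" for k
    using op_power_commute[OF assms] by (metis blinfun_apply_blinfun_compose)
  then show ?thesis
    by (simp add: ergodic_average_apply blinfun.scaleR_right blinfun.sum_right)
qed

text \<open>The two sums of powers differ by a shift, so only the end terms survive.\<close>

lemma ergodic_average_diff:
  "ergodic_average T n x - ergodic_average T n (T x) = (1 / real n) *\<^sub>R (x - op_power T n x)"
proof -
  have "op_power T k (T x) = op_power T (Suc k) x" for k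
    using op_power_commute[OF refl, of T k] by (metis blinfun_apply_blinfun_compose op_power.simps(2))
  then have "(\<Sum>k<n. op_power T k x) - (\<Sum>k<n. op_power T k (T x)) = x - op_power T n x"
    using sum_lessThan_telescope'[of "\<lambda>k. op_power T k x" n] by (simp add: sum_subtractf)
  then show ?thesis
    by (simp add: ergodic_average_apply flip: scaleR_diff_right)
qed

lemma norm_ergodic_average_diff_le:
  assumes "contraction_op T"
  shows "norm (ergodic_average T n (x - T x)) \<le> 2 * norm x / real n"
proof -
  have "norm (op_power T n x) \<le> 1 * norm x"
    using norm_op_power_le_one[OF assms] by (intro order_trans[OF norm_blinfun] mult_right_mono) auto
  then have "norm (x - op_power T n x) \<le> 2 * norm x"
    using norm_triangle_ineq4[of x "op_power T n x"] by simp
  then have "norm (x - op_power T n x) / real n \<le> 2 * norm x / real n"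
    by (rule divide_right_mono) simp
  then show ?thesis
    by (simp add: blinfun.diff_right ergodic_average_diff divide_inverse mult.commute)
qed

lemma ergodic_average_fixed:
  fixes T :: "'a::real_normed_vector \<Rightarrow>\<^sub>L 'a"
  assumes "T x = x" "n > 0"
  shows "ergodic_average T n x = x"
proof -
  have "op_power T k x = x" for k using assms(1) by (induction k) auto
  with assms(2) show ?thesis by (simp add: ergodic_average_apply sum_constant_scaleR)
qed

text \<open>Each \<open>x - op_power T k x\<close> telescopes into values of
  \<open>id_blinfun - T\<close>, and the vector in question is their mean. At \<open>n = 0\<close>
  it would be \<open>x\<close> itself.\<close>

lemma diff_ergodic_average_in_range:
  assumes "n > 0"
  shows "x - ergodic_average T n x \<in> range (id_blinfun - T)"
proof -
  let ?R = "range (id_blinfun - T)"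
  have sub: "subspace ?R"
    by (simp add: linear_subspace_image bounded_linear.linear[OF blinfun.bounded_linear_right])
  have pow: "x - op_power T k x \<in> ?R" for k
  proof (induction k)
    case 0
    show ?case by (simp add: subspace_0[OF sub])
  next
    case (Suc k)
    have "x - op_power T (Suc k) x = (x - op_power T k x) + (id_blinfun - T) (op_power T k x)"
      by (simp add: blinfun.diff_left)
    with Suc show ?case by (metis rangeI sub subspace_add)
  qed
  have "x - ergodic_average T n x = (1 / real n) *\<^sub>R (\<Sum>k<n. x - op_power T k x)"
    using assms by (simp add: ergodic_average_apply sum_subtractf scaleR_diff_right
        sum_constant_scaleR)
  then show ?thesis using pow sub by (simp add: subspace_scale subspace_sum)
qed

lemma mean_ergodic_pointwise:
  assumes "mean_ergodic T"
  obtains P :: "'a::real_normed_vector \<Rightarrow>\<^sub>L 'a" where "\<And>x. (\<lambda>n. ergodic_average T n x) \<longlonglongrightarrow> P x"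
proof -
  obtain P where P: "limitin strong_operator_topology (ergodic_average T) P sequentially"
    using assms by (auto simp: mean_ergodic_def)
  have "(\<lambda>n. ergodic_average T n x) \<longlonglongrightarrow> P x" for x
    using continuous_map_limit[OF strong_operator_topology_continuous_evaluation P, of x]
    by (simp add: o_def)
  then show ?thesis by (rule that)
qed

text \<open>\<open>P\<close> is a parameter so that two operators can later share one
  projection.\<close>

locale mean_ergodic_contraction =
  fixes T P :: "'a::banach \<Rightarrow>\<^sub>L 'a"
  assumes contraction: "contraction_op T"
    and average_tendsto: "\<And>x. (\<lambda>n. ergodic_average T n x) \<longlonglongrightarrow> P x"
begin

lemma projection_diff: "P (x - T x) = 0"
proof -
  have "(\<lambda>n. 2 * norm x / real n) \<longlonglongrightarrow> 0"
    by (rule lim_const_over_n)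
  then have "(\<lambda>n. ergodic_average T n (x - T x)) \<longlonglongrightarrow> 0"
    by (rule Lim_null_comparison[rotated])
      (simp add: norm_ergodic_average_diff_le[OF contraction])
  with average_tendsto show ?thesis using LIMSEQ_unique by blast
qed

lemma projection_operator: "P (T x) = P x"
  using projection_diff[of x] by (simp add: blinfun.diff_right)

lemma projection_commute:
  assumes "T o\<^sub>L S = S o\<^sub>L T"
  shows "P (S x) = S (P x)"
proof -
  have "(\<lambda>n. ergodic_average T n (S x)) \<longlonglongrightarrow> S (P x)"
    unfolding ergodic_average_commute[OF assms]
    by (intro tendsto_intros average_tendsto)
  with average_tendsto show ?thesis using LIMSEQ_unique by blast
qed

lemma operator_projection: "T (P x) = P x"
  using projection_commute[OF refl] projection_operator by simp

lemma projection_fixed: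
  assumes "T x = x"
  shows "P x = x"
proof -
  \<comment> \<open>The averages equal \<open>x\<close> only from index 1 on, since the average at 0
    is the zero operator.\<close>
  have "(\<lambda>n. ergodic_average T n x) \<longlonglongrightarrow> x"
    by (rule tendsto_eventually)
      (use ergodic_average_fixed[OF assms] in \<open>auto simp: eventually_sequentially intro: exI[of _ 1]\<close>)
  with average_tendsto show ?thesis using LIMSEQ_unique by blast
qed

lemma projection_idem: "P (P x) = P x"
  by (simp add: projection_fixed operator_projection)

lemma projection_average:
  assumes "n > 0"
  shows "P (ergodic_average T n x) = P x"
proof -
  have "P (x - ergodic_average T n x) = 0"
    using diff_ergodic_average_in_range[OF assms, of x T] projection_diff
    by (auto simp: blinfun.diff_left)
  then show ?thesis by (simp add: blinfun.diff_right)
qed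

lemma closed_kernel: "closed {x. P x = 0}"
  by (intro closed_Collect_eq continuous_intros)

lemma range_subset_kernel: "range (id_blinfun - T) \<subseteq> {x. P x = 0}"
  using projection_diff by (auto simp: blinfun.diff_left)

text \<open>If \<open>P x = 0\<close>, the vectors \<open>x - ergodic_average T n x\<close> tend to
  \<open>x\<close>, and for positive \<open>n\<close> they lie in the range; hence the shift to
  \<open>Suc n\<close>.\<close>

lemma closure_range: "closure (range (id_blinfun - T)) = {x. P x = 0}"
proof
  show "closure (range (id_blinfun - T)) \<subseteq> {x. P x = 0}"
    by (intro closure_minimal range_subset_kernel closed_kernel)
  show "{x. P x = 0} \<subseteq> closure (range (id_blinfun - T))"
  proof safe
    fix x assume "P x = 0"
    then have "(\<lambda>n. x - ergodic_average T (Suc n) x) \<longlonglongrightarrow> x - 0"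
      using LIMSEQ_Suc[OF average_tendsto[of x]] by (intro tendsto_intros) simp
    then show "x \<in> closure (range (id_blinfun - T))"
      unfolding closure_sequential using diff_ergodic_average_in_range[of "Suc _" x T]
      by (intro exI[of _ "\<lambda>n. x - ergodic_average T (Suc n) x"]) auto
  qed
qed

text \<open>Subtracting the fixed vector \<open>P x\<close> from \<open>x\<close> moves it into the
  kernel without changing its image.\<close>

lemma image_kernel: "(id_blinfun - T) ` {x. P x = 0} = range (id_blinfun - T)"
proof safe
  fix x
  have "(id_blinfun - T) x = (id_blinfun - T) (x - P x)"
    by (simp add: blinfun.diff_left blinfun.diff_right operator_projection)
  moreover have "P (x - P x) = 0"
    by (simp add: blinfun.diff_right projection_idem)
  ultimately show "(id_blinfun - T) x \<in> (id_blinfun - T) ` {x. P x = 0}" by blast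
qed auto

section \<open>Lin's theorem: uniform ergodicity and the range of
  \<open>id_blinfun - T\<close>\<close>

lemma closed_range_imp_uniformly_ergodic:
  assumes "closed (range (id_blinfun - T))"
  shows "uniformly_ergodic T"
proof -
  have range: "range (id_blinfun - T) = {x. P x = 0}"
    using closure_range assms by (simp add: closure_closed)
  obtain C where C: "C \<ge> 0"
      "\<And>y. y \<in> range (id_blinfun - T) \<Longrightarrow> \<exists>x. (id_blinfun - T) x = y \<and> norm x \<le> C * norm y"
    using closed_range_bounded_preimage[OF assms] by blast
  \<comment> \<open>\<open>C * norm (id_blinfun - P)\<close> bounds the solution \<open>z\<close>
    relative to \<open>norm x\<close>; the factor 2 bounds the telescoped difference of
    \<open>z\<close> and its \<open>n\<close>-th iterate.\<close>
  define K where "K = 2 * (C * norm (id_blinfun - P))"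
  have K: "K \<ge> 0" using C by (simp add: K_def)
  have bound: "norm (ergodic_average T n - P) \<le> K / real n" if n: "n > 0" for n
  proof (rule norm_blinfun_bound)
    fix x
    have "x - P x \<in> range (id_blinfun - T)"
      by (simp add: range blinfun.diff_right projection_idem)
    then obtain z where z: "z - T z = x - P x" "norm z \<le> C * norm (x - P x)"
      using C(2) by (auto simp: blinfun.diff_left)
    have "norm (x - P x) \<le> norm (id_blinfun - P) * norm x"
      using norm_blinfun[of "id_blinfun - P" x] by (simp add: blinfun.diff_left)
    then have nz: "2 * norm z \<le> K * norm x"
      using z(2) mult_left_mono[OF _ C(1)] by (force simp: K_def mult.assoc)
    \<comment> \<open>\<open>P x\<close> is fixed by \<open>T\<close>, hence by every average with
      \<open>n > 0\<close>.\<close>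
    have "(ergodic_average T n - P) x = ergodic_average T n (x - P x)"
      using ergodic_average_fixed[OF operator_projection n]
      by (simp add: blinfun.diff_left blinfun.diff_right)
    then have "norm ((ergodic_average T n - P) x) \<le> 2 * norm z / real n"
      using norm_ergodic_average_diff_le[OF contraction, of n z] z(1) by simp
    also have "\<dots> \<le> (K * norm x) / real n"
      using nz by (rule divide_right_mono) simp
    finally show "norm ((ergodic_average T n - P) x) \<le> K / real n * norm x" by simp
  qed (use K in simp)
  have "(\<lambda>n. ergodic_average T n - P) \<longlonglongrightarrow> 0"
    by (rule Lim_null_comparison[OF _ lim_const_over_n[of K]])
      (use bound in \<open>auto simp: eventually_sequentially intro!: exI[of _ 1]\<close>)
  then show ?thesis
    unfolding uniformly_ergodic_def convergent_def using LIM_zero_cancel by blast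
qed

text \<open>Norm convergence implies pointwise convergence, so the norm limit agrees with
  \<open>P\<close> at each vector.\<close>

lemma uniformly_ergodic_tendsto:
  assumes "uniformly_ergodic T"
  shows "ergodic_average T \<longlonglongrightarrow> P"
proof -
  obtain Q where Q: "ergodic_average T \<longlonglongrightarrow> Q"
    using assms by (auto simp: uniformly_ergodic_def convergent_def)
  have "P x = Q x" for x
  proof -
    have "(\<lambda>n. ergodic_average T n x) \<longlonglongrightarrow> Q x"
      by (intro tendsto_intros Q)
    with average_tendsto show ?thesis using LIMSEQ_unique by blast
  qed
  then have "P = Q" by (rule blinfun_eqI)
  with Q show ?thesis by simp
qed

text \<open>For large \<open>n\<close> the average is within distance less than 1 of \<open>P\<close>, so Banach's fixed point
  theorem solves \<open>x = y + (A\<^sub>n - P) x\<close>; if \<open>P y = 0\<close>, applying \<open>P\<close> gives \<open>P x = 0\<close>, and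
  \<open>y = x - A\<^sub>n x\<close> lies in the range of \<open>I - T\<close>.\<close>

lemma uniformly_ergodic_imp_range:
  assumes "uniformly_ergodic T"
  shows "range (id_blinfun - T) = {x. P x = 0}"
proof
  show "{x. P x = 0} \<subseteq> range (id_blinfun - T)"
  proof safe
    fix y assume y: "P y = 0"
    have "eventually (\<lambda>n. dist (ergodic_average T n) P < 1) sequentially"
      using uniformly_ergodic_tendsto[OF assms] by (rule tendstoD) simp
    then obtain N where N: "\<And>n. n \<ge> N \<Longrightarrow> dist (ergodic_average T n) P < 1"
      by (auto simp: eventually_sequentially)
    define n where "n = Suc N"
    define E where "E = ergodic_average T n - P"
    have n: "n > 0" and E: "norm E < 1"
      using N[of n] by (auto simp: n_def E_def dist_norm)
    have "\<exists>!x. y + E x = x"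
    proof (rule banach_fix_type)
      show "\<forall>x z. dist (y + E x) (y + E z) \<le> norm E * dist x z"
        by (simp add: dist_norm norm_blinfun flip: blinfun.diff_right)
    qed (use E in auto)
    then obtain x where x: "y + E x = x" by blast
    have "P x = P y + P (E x)" using x by (metis blinfun.add_right)
    also have "P (E x) = 0"
      by (simp add: E_def blinfun.diff_left blinfun.diff_right projection_average n projection_idem)
    finally have "P x = 0" using y by simp
    then have "y = x - ergodic_average T n x"
      using x by (simp add: E_def blinfun.diff_left algebra_simps)
    then show "y \<in> range (id_blinfun - T)"
      using diff_ergodic_average_in_range[OF n] by simp
  qed
qed (rule range_subset_kernel)

end

section \<open>Two commuting operators with a common fixed space\<close>

lemma mean_ergodic_projection_eq:
  assumes "mean_ergodic_contraction T P" "mean_ergodic_contraction S Q"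
    and comm: "T o\<^sub>L S = S o\<^sub>L T" and fixed: "fixed_space T = fixed_space S"
  shows "P = Q"
proof (rule blinfun_eqI)
  interpret T: mean_ergodic_contraction T P by fact
  interpret S: mean_ergodic_contraction S Q by fact
  have fix_iff: "T z = z \<longleftrightarrow> S z = z" for z
    using fixed by (auto simp: fixed_space_def)
  fix x
  \<comment> \<open>\<open>Q\<close> commutes with \<open>T\<close>, and \<open>Q z\<close> is fixed
    by \<open>S\<close>, hence also by \<open>T\<close>.\<close>
  have "Q (T z) = Q z" for z
    using S.projection_commute[OF comm[symmetric], of z] S.operator_projection fix_iff by simp
  then have "range (id_blinfun - T) \<subseteq> {z. Q z = 0}"
    by (auto simp: blinfun.diff_left blinfun.diff_right)
  then have "{z. P z = 0} \<subseteq> {z. Q z = 0}"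
    unfolding T.closure_range[symmetric] by (rule closure_minimal) (rule S.closed_kernel)
  \<comment> \<open>In the splitting of \<open>x\<close> into \<open>P x\<close> and
    \<open>x - P x\<close>, \<open>Q\<close> fixes the first part and kills the second, just as
    \<open>P\<close> does.\<close>
  moreover have "P (x - P x) = 0"
    by (simp add: blinfun.diff_right T.projection_idem)
  ultimately have "Q (x - P x) = 0" by blast
  then have "Q x = Q (P x)" by (simp add: blinfun.diff_right)
  also have "\<dots> = P x"
    using S.projection_fixed T.operator_projection fix_iff by blast
  finally show "P x = Q x" by simp
qed

theorem theorem2p5:
  fixes T S :: "'a::banach \<Rightarrow>\<^sub>L 'a"
  assumes "contraction_op T" and "contraction_op S"
    and "T o\<^sub>L S = S o\<^sub>L T"
    and "mean_ergodic T" and "mean_ergodic S"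
    and "fixed_space T = fixed_space S"
  shows "closed (range (blinfun_apply ((id_blinfun - T) o\<^sub>L (id_blinfun - S))))
           \<longleftrightarrow> uniformly_ergodic T \<and> uniformly_ergodic S"
proof -
  obtain P :: "'a \<Rightarrow>\<^sub>L 'a" where "\<And>x. (\<lambda>n. ergodic_average T n x) \<longlonglongrightarrow> P x"
    using mean_ergodic_pointwise[OF assms(4)] by blast
  then have T': "mean_ergodic_contraction T P"
    using assms(1) by unfold_locales
  obtain Q :: "'a \<Rightarrow>\<^sub>L 'a" where "\<And>x. (\<lambda>n. ergodic_average S n x) \<longlonglongrightarrow> Q x"
    using mean_ergodic_pointwise[OF assms(5)] by blast
  then have S': "mean_ergodic_contraction S Q"
    using assms(2) by unfold_locales
  then have "mean_ergodic_contraction S P"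
    using mean_ergodic_projection_eq[OF T' S' assms(3,6)] by simp
  then interpret S: mean_ergodic_contraction S P .
  interpret T: mean_ergodic_contraction T P by (rule T')
  let ?A = "id_blinfun - T" and ?B = "id_blinfun - S"
  let ?N = "{x. P x = 0}"
  have AB: "range (?A o\<^sub>L ?B) = ?A ` range ?B"
    by auto
  have "T (S x) = S (T x)" for x
    using assms(3) by (metis blinfun_apply_blinfun_compose)
  \<comment> \<open>Since the factors commute, the range of the product lies in the range of each of
    them.\<close>
  then have BA: "?A o\<^sub>L ?B = ?B o\<^sub>L ?A"
    by (intro blinfun_eqI) (simp add: blinfun.diff_left blinfun.diff_right)
  show ?thesis
  proof
    assume closed: "closed (range (?A o\<^sub>L ?B))"
    \<comment> \<open>By continuity \<open>?A\<close> maps \<open>closure (range ?B)\<close>, which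
      is \<open>?N\<close>, into the closed range of the product; but \<open>?A\<close> already
      attains its whole range on \<open>?N\<close>.\<close>
    have "?A ` closure (range ?B) \<subseteq> range (?A o\<^sub>L ?B)"
      using closed by (intro image_closure_subset continuous_intros) (auto simp: AB)
    then have "range ?A \<subseteq> range (?A o\<^sub>L ?B)"
      by (simp add: S.closure_range T.image_kernel)
    then have N: "?N \<subseteq> range (?A o\<^sub>L ?B)"
      unfolding T.closure_range[symmetric] using closed by (rule closure_minimal)
    have "range (?A o\<^sub>L ?B) \<subseteq> range ?A" by auto
    then have "range ?A = ?N" using N T.range_subset_kernel by blast
    moreover have "range (?A o\<^sub>L ?B) \<subseteq> range ?B" unfolding BA by auto
    then have "range ?B = ?N" using N S.range_subset_kernel by blast
    ultimately show "uniformly_ergodic T \<and> uniformly_ergodic S"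
      using T.closed_kernel T.closed_range_imp_uniformly_ergodic
        S.closed_range_imp_uniformly_ergodic by simp
  next
    assume "uniformly_ergodic T \<and> uniformly_ergodic S"
    then have "range ?A = ?N" "range ?B = ?N"
      using T.uniformly_ergodic_imp_range S.uniformly_ergodic_imp_range by blast+
    then have "range (?A o\<^sub>L ?B) = ?N"
      using T.image_kernel by (simp only: AB)
    then show "closed (range (?A o\<^sub>L ?B))"
      using T.closed_kernel by simp
  qed
qed

end
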